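(* For every $k\in\mathbb{N}\cup\{\infty\}$, $(\mathsf{DMTS},\chi,\trianglelefteq_k)$ is a specification theory for $\mathsf{LTS}$ adequate for $\approx_k$, and $(\mathsf{DMTS},\chi,\trianglelefteq_k^{\mathrm r})$ is a specification theory for $\mathsf{LTS}$ adequate for $\approx_k^{\mathrm r}$.
   Context: Fix a finite alphabet $\Sigma$. An LTS is $(S,s^0,T)$ with $S$ finite, $s^0\in S$, $T\subseteq S\times\Sigma\times S$; $\mathsf{LTS}$ is the set of all LTS. $T^*\subseteq S\times\Sigma^*\times S$ is defined by: $(s,\epsilon,s)\in T^*$; if $(s,\tau,t)\in T^*$ and $(t,a,u)\in T$ then $(s,\tau.a,u)\in T^*$. A DMTS is $D=(S,S^0,\dashrightarrow,\longrightarrow)$ with $S$ finite, $S^0\subseteq S$, $\dashrightarrow\subseteq S\times\Sigma\times S$ (written $s\overset{a}{\dashrightarrow}t$), $\longrightarrow\subseteq S\times2^{\Sigma\times S}$ (written $s\longrightarrow N$), such that $s\longrightarrow N$, $(a,t)\in N$ imply $s\overset{a}{\dashrightarrow}t$; $\mathsf{DMTS}$ is the set of all DMTS. For $I=(S,s^0,T)$, $\chi(I)=(S,\{s^0\},T,\{(s,\{(a,t)\})\mid(s,a,t)\in T\})$. For a DMTS define trace relations $\overset{\tau}{\dashrightarrow\!\!\!^*}$ and $\overset{\tau}{\longrightarrow^*}$ on $S$ ($\tau\in\Sigma^*$): $s\overset{\epsilon}{\dashrightarrow^*}s$ and $s\overset{\epsilon}{\longrightarrow^*}s$; if $s\overset{\tau}{\dashrightarrow^*}t$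 and $t\overset{a}{\dashrightarrow}u$ then $s\overset{\tau.a}{\dashrightarrow^*}u$; if $s\overset{\tau}{\longrightarrow^*}t$, $t\longrightarrow N$ and $(a,u)\in N$ then $s\overset{\tau.a}{\longrightarrow^*}u$. Indices $j$ range over $\{0,\dots,k\}$ (over $\mathbb{N}$ when $k=\infty$, in which case "$j<k$" always holds and the "ready" extra conditions, which concern the last relation, are vacuous). LTS: for $I_i=(S_i,s^0_i,T_i)$, a linear $k$-switching relation family from $I_1$ to $I_2$ is $R^0,\dots,R^k\subseteq S_1\times S_2$ with $(s^0_1,s^0_2)\in R^0$ and: for even $j$ and $(s_1,s_2)\in R^j$: for every $(s_1,\tau,t_1)\in T_1^*$ there is $(s_2,\tau,t_2)\in T_2^*$, and if $j<k$, for every $(s_1,\tau,t_1)\in T_1^*$ there is $(s_2,\tau,t_2)\in T_2^*$ with $(t_1,t_2)\in R^{j+1}$; for odd $j$ and $(s_1,s_2)\in R^j$: for every $(s_2,\tau,t_2)\in T_2^*$ there is $(s_1,\tau,t_1)\in T_1^*$, and if $j<k$, for every $(s_2,\tau,t_2)\in T_2^*$ there is $(s_1,\tau,t_1)\in T_1^*$ with $(t_1,t_2)\in R^{j+1}$. A linear $k$-ready relation family additionally satisfies for all $(s_1,s_2)\in R^k$: if $k$ is even, for every $(s_1,\tau,t_1)\in T_1^*$ there is $(s_2,\tau,t_2)\in T_2^*$ such that for every $(t_2,a,u_2)\in T_2$ there is some $(t_1,a,u_1)\in T_1$; if $k$ is odd, for every $(s_2,\tau,t_2)\in T_2^*$ there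 is $(s_1,\tau,t_1)\in T_1^*$ such that for every $(t_1,a,u_1)\in T_1$ there is some $(t_2,a,u_2)\in T_2$. $I_1\approx_kI_2$ iff there are linear $k$-switching relation families from $I_1$ to $I_2$ and from $I_2$ to $I_1$; $I_1\approx_k^{\mathrm r}I_2$ likewise with linear $k$-ready families. DMTS: for $D_i=(S_i,S^0_i,\dashrightarrow_i,\longrightarrow_i)$ and $R\subseteq S_1\times S_2$, say $(s_1,s_2)$ satisfies LMAY$(R)$ if for every $s_1\overset{\tau}{\dashrightarrow^*_1}t_1$ there is $s_2\overset{\tau}{\dashrightarrow^*_2}t_2$ with $(t_1,t_2)\in R$, LMAY if the same holds without the requirement $(t_1,t_2)\in R$, LMUST$(R)$ if for every $s_2\overset{\tau}{\longrightarrow^*_2}t_2$ there is $s_1\overset{\tau}{\longrightarrow^*_1}t_1$ with $(t_1,t_2)\in R$, and LMUST likewise without $R$. A linear $k$-switching relation family from $D_1$ to $D_2$ is $R_1^0,\dots,R_1^k,R_2^0,\dots,R_2^k\subseteq S_1\times S_2$ with: every $s^0_1\in S^0_1$ has $s^0_2\in S^0_2$ with $(s^0_1,s^0_2)\in R_1^0$, every $s^0_2\in S^0_2$ has $s^0_1\in S^0_1$ with $(s^0_1,s^0_2)\in R_2^0$; for even $j$, pairs in $R_1^j$ satisfy LMAY and, if $j<k$, LMAY$(R_1^{j+1})$; for odd $j$, pairs in $R_1^j$ satisfy LMUST and, if $j<k$, LMUST$(R_1^{j+1})$; for even $j$, pairs in $R_2^j$ satisfy LMUST and, if $j<k$, LMUST$(R_2^{j+1})$;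 for odd $j$, pairs in $R_2^j$ satisfy LMAY and, if $j<k$, LMAY$(R_2^{j+1})$. A linear $k$-ready relation family additionally satisfies, writing (A) for "for every $s_1\overset{\tau}{\dashrightarrow^*_1}t_1$ there is $s_2\overset{\tau}{\dashrightarrow^*_2}t_2$ such that for every $t_2\longrightarrow_2N_2$ there is $t_1\longrightarrow_1N_1$ such that for every $(a,u_1)\in N_1$ there is some $(a,u_2)\in N_2$" and (B) for "for every $s_2\overset{\tau}{\longrightarrow^*_2}t_2$ there is $s_1\overset{\tau}{\longrightarrow^*_1}t_1$ such that for every $t_1\overset{a}{\dashrightarrow}_1u_1$ there is some $t_2\overset{a}{\dashrightarrow}_2u_2$": if $k$ is even, every $(s_1,s_2)\in R_1^k$ satisfies (A) and every $(s_1,s_2)\in R_2^k$ satisfies (B); if $k$ is odd, every $(s_1,s_2)\in R_1^k$ satisfies (B) and every $(s_1,s_2)\in R_2^k$ satisfies (A). $D_1\trianglelefteq_kD_2$ iff there is a linear $k$-switching relation family from $D_1$ to $D_2$; $D_1\trianglelefteq_k^{\mathrm r}D_2$ iff there is a linear $k$-ready one. A specification theory for a set $\mathsf{Proc}$ is a triple $(\mathsf{Spec},\chi,\le)$, $\chi:\mathsf{Proc}\to\mathsf{Spec}$, $\le$ a preorder on $\mathsf{Spec}$, such that with $I\models S$ iff $\chi(I)\le S$, for each $I$: $I\models\chi(I)$ and every $I'\models\chi(I)$ has $\mathrm{Th}(I')=\mathrm{Th}(I)$, where $\mathrm{Th}(I)=\{S\mid I\models S\}$. It is adequate for an equivalence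 $\sim$ on $\mathsf{Proc}$ if $\mathrm{Th}(I_1)=\mathrm{Th}(I_2)\iff I_1\sim I_2$. *)

theory Defs
  imports Main "HOL-Library.Extended_Nat"
begin

text \<open>
  The fixed finite alphabet is a set \<open>\<Sigma>\<close>, so that it may also be empty. States are drawn
  from an arbitrary type.
\<close>

section \<open>Specification theories\<close>

definition models :: "('p \<Rightarrow> 'd) \<Rightarrow> ('d \<Rightarrow> 'd \<Rightarrow> bool) \<Rightarrow> 'p \<Rightarrow> 'd \<Rightarrow> bool" where
  "models \<chi> le I D \<longleftrightarrow> le (\<chi> I) D"

definition Th :: "'d set \<Rightarrow> ('p \<Rightarrow> 'd) \<Rightarrow> ('d \<Rightarrow> 'd \<Rightarrow> bool) \<Rightarrow> 'p \<Rightarrow> 'd set" where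
  "Th Spec \<chi> le I = {D \<in> Spec. models \<chi> le I D}"

definition specification_theory ::
  "'p set \<Rightarrow> 'd set \<Rightarrow> ('p \<Rightarrow> 'd) \<Rightarrow> ('d \<Rightarrow> 'd \<Rightarrow> bool) \<Rightarrow> bool" where
  "specification_theory Proc Spec \<chi> le \<longleftrightarrow>
     \<chi> ` Proc \<subseteq> Spec \<and>
     reflp_on Spec le \<and> transp_on Spec le \<and>
     (\<forall>I\<in>Proc. models \<chi> le I (\<chi> I) \<and>
        (\<forall>I'\<in>Proc. models \<chi> le I' (\<chi> I) \<longrightarrow> Th Spec \<chi> le I' = Th Spec \<chi> le I))"

text \<open>Adequacy is only defined for equivalences, hence the first three conjuncts.\<close>

definition adequate_for ::
  "'p set \<Rightarrow> 'd set \<Rightarrow> ('p \<Rightarrow> 'd) \<Rightarrow> ('d \<Rightarrow> 'd \<Rightarrow> bool) \<Rightarrow> ('p \<Rightarrow> 'p \<Rightarrow> bool) \<Rightarrow> bool" where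
  "adequate_for Proc Spec \<chi> le eq \<longleftrightarrow>
     reflp_on Proc eq \<and> symp_on Proc eq \<and> transp_on Proc eq \<and>
     (\<forall>I1\<in>Proc. \<forall>I2\<in>Proc. Th Spec \<chi> le I1 = Th Spec \<chi> le I2 \<longleftrightarrow> eq I1 I2)"


section \<open>Labelled transition systems\<close>

record ('s, 'a) lts =
  lstates :: "'s set"
  linit :: 's
  ltrans :: "('s \<times> 'a \<times> 's) set"

definition LTS :: "'a set \<Rightarrow> ('s, 'a) lts set" where
  "LTS \<Sigma> = {I. finite (lstates I) \<and> linit I \<in> lstates I \<and>
                ltrans I \<subseteq> lstates I \<times> \<Sigma> \<times> lstates I}"

inductive_set ltraces :: "('s, 'a) lts \<Rightarrow> ('s \<times> 'a list \<times> 's) set" for I where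
  empty: "s \<in> lstates I \<Longrightarrow> (s, [], s) \<in> ltraces I"
| snoc: "(s, \<tau>, t) \<in> ltraces I \<Longrightarrow> (t, a, u) \<in> ltrans I \<Longrightarrow> (s, \<tau> @ [a], u) \<in> ltraces I"

text \<open>
  A family is indexed by all naturals, but only its members with index \<open>j \<le> k\<close> are constrained
  or used; the index bound \<open>k = \<infinity>\<close> is covered by \<^typ>\<open>enat\<close>.
\<close>

definition lts_switching_family ::
  "enat \<Rightarrow> ('s, 'a) lts \<Rightarrow> ('t, 'a) lts \<Rightarrow> (nat \<Rightarrow> ('s \<times> 't) set) \<Rightarrow> bool" where
  "lts_switching_family k I1 I2 R \<longleftrightarrow>
     (\<forall>j. enat j \<le> k \<longrightarrow> R j \<subseteq> lstates I1 \<times> lstates I2) \<and>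
     (linit I1, linit I2) \<in> R 0 \<and>
     (\<forall>j s1 s2. enat j \<le> k \<longrightarrow> even j \<longrightarrow> (s1, s2) \<in> R j \<longrightarrow>
        (\<forall>\<tau> t1. (s1, \<tau>, t1) \<in> ltraces I1 \<longrightarrow> (\<exists>t2. (s2, \<tau>, t2) \<in> ltraces I2)) \<and>
        (enat j < k \<longrightarrow>
          (\<forall>\<tau> t1. (s1, \<tau>, t1) \<in> ltraces I1 \<longrightarrow>
             (\<exists>t2. (s2, \<tau>, t2) \<in> ltraces I2 \<and> (t1, t2) \<in> R (j + 1))))) \<and>
     (\<forall>j s1 s2. enat j \<le> k \<longrightarrow> odd j \<longrightarrow> (s1, s2) \<in> R j \<longrightarrow>
        (\<forall>\<tau> t2. (s2, \<tau>, t2) \<in> ltraces I2 \<longrightarrow> (\<exists>t1. (s1, \<tau>, t1) \<in> ltraces I1)) \<and>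
        (enat j < k \<longrightarrow>
          (\<forall>\<tau> t2. (s2, \<tau>, t2) \<in> ltraces I2 \<longrightarrow>
             (\<exists>t1. (s1, \<tau>, t1) \<in> ltraces I1 \<and> (t1, t2) \<in> R (j + 1)))))"

definition lts_ready_family ::
  "enat \<Rightarrow> ('s, 'a) lts \<Rightarrow> ('t, 'a) lts \<Rightarrow> (nat \<Rightarrow> ('s \<times> 't) set) \<Rightarrow> bool" where
  "lts_ready_family k I1 I2 R \<longleftrightarrow>
     lts_switching_family k I1 I2 R \<and>
     (\<forall>n s1 s2. k = enat n \<longrightarrow> (s1, s2) \<in> R n \<longrightarrow>
        (even n \<longrightarrow>
          (\<forall>\<tau> t1. (s1, \<tau>, t1) \<in> ltraces I1 \<longrightarrow>
             (\<exists>t2. (s2, \<tau>, t2) \<in> ltraces I2 \<and>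
                (\<forall>a u2. (t2, a, u2) \<in> ltrans I2 \<longrightarrow> (\<exists>u1. (t1, a, u1) \<in> ltrans I1))))) \<and>
        (odd n \<longrightarrow>
          (\<forall>\<tau> t2. (s2, \<tau>, t2) \<in> ltraces I2 \<longrightarrow>
             (\<exists>t1. (s1, \<tau>, t1) \<in> ltraces I1 \<and>
                (\<forall>a u1. (t1, a, u1) \<in> ltrans I1 \<longrightarrow> (\<exists>u2. (t2, a, u2) \<in> ltrans I2))))))"

definition lts_switching_equiv :: "enat \<Rightarrow> ('s, 'a) lts \<Rightarrow> ('t, 'a) lts \<Rightarrow> bool" where
  "lts_switching_equiv k I1 I2 \<longleftrightarrow>
     (\<exists>R. lts_switching_family k I1 I2 R) \<and> (\<exists>R. lts_switching_family k I2 I1 R)"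

definition lts_ready_equiv :: "enat \<Rightarrow> ('s, 'a) lts \<Rightarrow> ('t, 'a) lts \<Rightarrow> bool" where
  "lts_ready_equiv k I1 I2 \<longleftrightarrow>
     (\<exists>R. lts_ready_family k I1 I2 R) \<and> (\<exists>R. lts_ready_family k I2 I1 R)"


section \<open>Disjunctive modal transition systems\<close>

record ('s, 'a) dmts =
  dstates :: "'s set"
  dinit :: "'s set"
  dmay :: "('s \<times> 'a \<times> 's) set"
  dmust :: "('s \<times> ('a \<times> 's) set) set"

definition DMTS :: "'a set \<Rightarrow> ('s, 'a) dmts set" where
  "DMTS \<Sigma> = {D. finite (dstates D) \<and> dinit D \<subseteq> dstates D \<and>
                 dmay D \<subseteq> dstates D \<times> \<Sigma> \<times> dstates D \<and>
                 dmust D \<subseteq> dstates D \<times> Pow (\<Sigma> \<times> dstates D) \<and>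
                 (\<forall>s N a t. (s, N) \<in> dmust D \<longrightarrow> (a, t) \<in> N \<longrightarrow> (s, a, t) \<in> dmay D)}"

definition chi :: "('s, 'a) lts \<Rightarrow> ('s, 'a) dmts" where
  "chi I = \<lparr>dstates = lstates I, dinit = {linit I}, dmay = ltrans I,
            dmust = {(s, {(a, t)}) | s a t. (s, a, t) \<in> ltrans I}\<rparr>"

inductive_set may_traces :: "('s, 'a) dmts \<Rightarrow> ('s \<times> 'a list \<times> 's) set" for D where
  empty: "s \<in> dstates D \<Longrightarrow> (s, [], s) \<in> may_traces D"
| snoc: "(s, \<tau>, t) \<in> may_traces D \<Longrightarrow> (t, a, u) \<in> dmay D \<Longrightarrow> (s, \<tau> @ [a], u) \<in> may_traces D"

inductive_set must_traces :: "('s, 'a) dmts \<Rightarrow> ('s \<times> 'a list \<times> 's) set" for D where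
  empty: "s \<in> dstates D \<Longrightarrow> (s, [], s) \<in> must_traces D"
| snoc: "(s, \<tau>, t) \<in> must_traces D \<Longrightarrow> (t, N) \<in> dmust D \<Longrightarrow> (a, u) \<in> N \<Longrightarrow>
         (s, \<tau> @ [a], u) \<in> must_traces D"

definition lmay :: "('s, 'a) dmts \<Rightarrow> ('t, 'a) dmts \<Rightarrow> 's \<Rightarrow> 't \<Rightarrow> bool" where
  "lmay D1 D2 s1 s2 \<longleftrightarrow>
     (\<forall>\<tau> t1. (s1, \<tau>, t1) \<in> may_traces D1 \<longrightarrow> (\<exists>t2. (s2, \<tau>, t2) \<in> may_traces D2))"

definition lmay_rel ::
  "('s, 'a) dmts \<Rightarrow> ('t, 'a) dmts \<Rightarrow> ('s \<times> 't) set \<Rightarrow> 's \<Rightarrow> 't \<Rightarrow> bool" where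
  "lmay_rel D1 D2 R s1 s2 \<longleftrightarrow>
     (\<forall>\<tau> t1. (s1, \<tau>, t1) \<in> may_traces D1 \<longrightarrow>
        (\<exists>t2. (s2, \<tau>, t2) \<in> may_traces D2 \<and> (t1, t2) \<in> R))"

definition lmust :: "('s, 'a) dmts \<Rightarrow> ('t, 'a) dmts \<Rightarrow> 's \<Rightarrow> 't \<Rightarrow> bool" where
  "lmust D1 D2 s1 s2 \<longleftrightarrow>
     (\<forall>\<tau> t2. (s2, \<tau>, t2) \<in> must_traces D2 \<longrightarrow> (\<exists>t1. (s1, \<tau>, t1) \<in> must_traces D1))"

definition lmust_rel ::
  "('s, 'a) dmts \<Rightarrow> ('t, 'a) dmts \<Rightarrow> ('s \<times> 't) set \<Rightarrow> 's \<Rightarrow> 't \<Rightarrow> bool" where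
  "lmust_rel D1 D2 R s1 s2 \<longleftrightarrow>
     (\<forall>\<tau> t2. (s2, \<tau>, t2) \<in> must_traces D2 \<longrightarrow>
        (\<exists>t1. (s1, \<tau>, t1) \<in> must_traces D1 \<and> (t1, t2) \<in> R))"

definition lmay_ready :: "('s, 'a) dmts \<Rightarrow> ('t, 'a) dmts \<Rightarrow> 's \<Rightarrow> 't \<Rightarrow> bool" where
  "lmay_ready D1 D2 s1 s2 \<longleftrightarrow>
     (\<forall>\<tau> t1. (s1, \<tau>, t1) \<in> may_traces D1 \<longrightarrow>
        (\<exists>t2. (s2, \<tau>, t2) \<in> may_traces D2 \<and>
           (\<forall>N2. (t2, N2) \<in> dmust D2 \<longrightarrow>
              (\<exists>N1. (t1, N1) \<in> dmust D1 \<and>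
                 (\<forall>a u1. (a, u1) \<in> N1 \<longrightarrow> (\<exists>u2. (a, u2) \<in> N2))))))"

definition lmust_ready :: "('s, 'a) dmts \<Rightarrow> ('t, 'a) dmts \<Rightarrow> 's \<Rightarrow> 't \<Rightarrow> bool" where
  "lmust_ready D1 D2 s1 s2 \<longleftrightarrow>
     (\<forall>\<tau> t2. (s2, \<tau>, t2) \<in> must_traces D2 \<longrightarrow>
        (\<exists>t1. (s1, \<tau>, t1) \<in> must_traces D1 \<and>
           (\<forall>a u1. (t1, a, u1) \<in> dmay D1 \<longrightarrow> (\<exists>u2. (t2, a, u2) \<in> dmay D2))))"

definition dmts_switching_family ::
  "enat \<Rightarrow> ('s, 'a) dmts \<Rightarrow> ('t, 'a) dmts \<Rightarrow>
     (nat \<Rightarrow> ('s \<times> 't) set) \<Rightarrow> (nat \<Rightarrow> ('s \<times> 't) set) \<Rightarrow> bool" where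
  "dmts_switching_family k D1 D2 R1 R2 \<longleftrightarrow>
     (\<forall>j. enat j \<le> k \<longrightarrow>
        R1 j \<subseteq> dstates D1 \<times> dstates D2 \<and> R2 j \<subseteq> dstates D1 \<times> dstates D2) \<and>
     (\<forall>s1\<in>dinit D1. \<exists>s2\<in>dinit D2. (s1, s2) \<in> R1 0) \<and>
     (\<forall>s2\<in>dinit D2. \<exists>s1\<in>dinit D1. (s1, s2) \<in> R2 0) \<and>
     (\<forall>j s1 s2. enat j \<le> k \<longrightarrow> even j \<longrightarrow> (s1, s2) \<in> R1 j \<longrightarrow>
        lmay D1 D2 s1 s2 \<and> (enat j < k \<longrightarrow> lmay_rel D1 D2 (R1 (j + 1)) s1 s2)) \<and>
     (\<forall>j s1 s2. enat j \<le> k \<longrightarrow> odd j \<longrightarrow> (s1, s2) \<in> R1 j \<longrightarrow>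
        lmust D1 D2 s1 s2 \<and> (enat j < k \<longrightarrow> lmust_rel D1 D2 (R1 (j + 1)) s1 s2)) \<and>
     (\<forall>j s1 s2. enat j \<le> k \<longrightarrow> even j \<longrightarrow> (s1, s2) \<in> R2 j \<longrightarrow>
        lmust D1 D2 s1 s2 \<and> (enat j < k \<longrightarrow> lmust_rel D1 D2 (R2 (j + 1)) s1 s2)) \<and>
     (\<forall>j s1 s2. enat j \<le> k \<longrightarrow> odd j \<longrightarrow> (s1, s2) \<in> R2 j \<longrightarrow>
        lmay D1 D2 s1 s2 \<and> (enat j < k \<longrightarrow> lmay_rel D1 D2 (R2 (j + 1)) s1 s2))"

definition dmts_ready_family ::
  "enat \<Rightarrow> ('s, 'a) dmts \<Rightarrow> ('t, 'a) dmts \<Rightarrow>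
     (nat \<Rightarrow> ('s \<times> 't) set) \<Rightarrow> (nat \<Rightarrow> ('s \<times> 't) set) \<Rightarrow> bool" where
  "dmts_ready_family k D1 D2 R1 R2 \<longleftrightarrow>
     dmts_switching_family k D1 D2 R1 R2 \<and>
     (\<forall>n. k = enat n \<longrightarrow>
        (even n \<longrightarrow>
          (\<forall>s1 s2. (s1, s2) \<in> R1 n \<longrightarrow> lmay_ready D1 D2 s1 s2) \<and>
          (\<forall>s1 s2. (s1, s2) \<in> R2 n \<longrightarrow> lmust_ready D1 D2 s1 s2)) \<and>
        (odd n \<longrightarrow>
          (\<forall>s1 s2. (s1, s2) \<in> R1 n \<longrightarrow> lmust_ready D1 D2 s1 s2) \<and>
          (\<forall>s1 s2. (s1, s2) \<in> R2 n \<longrightarrow> lmay_ready D1 D2 s1 s2)))"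

definition dmts_switching_refines :: "enat \<Rightarrow> ('s, 'a) dmts \<Rightarrow> ('t, 'a) dmts \<Rightarrow> bool" where
  "dmts_switching_refines k D1 D2 \<longleftrightarrow> (\<exists>R1 R2. dmts_switching_family k D1 D2 R1 R2)"

definition dmts_ready_refines :: "enat \<Rightarrow> ('s, 'a) dmts \<Rightarrow> ('t, 'a) dmts \<Rightarrow> bool" where
  "dmts_ready_refines k D1 D2 \<longleftrightarrow> (\<exists>R1 R2. dmts_ready_family k D1 D2 R1 R2)"

end

(* Both relations of the theorem reduce to one observation: chi I has the traces of I both as its
   may- and as its must-traces, so the two halves of a DMTS relation family between chi I1 and
   chi I2 are LTS relation families, the first one from I1 to I2 and the converse of the second
   one from I2 to I1. Hence refinement between implementations coincides with the (symmetric)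
   LTS equivalence, and everything else follows from refinement being a preorder. *)

theory Submission
  imports Defs
begin

section \<open>An abstract criterion for adequate specification theories\<close>

text \<open>If refinement restricted to implementations is symmetric, then \<open>I1\<close>
  refining \<open>I2\<close> puts \<open>\<chi> I1\<close> and \<open>\<chi> I2\<close> below each
  other, and transitivity of \<open>le\<close> carries every specification of one over to the
  other.\<close>

lemma specification_theory_adequate_forI:
  assumes \<chi>: "\<chi> ` Proc \<subseteq> Spec"
    and refl: "reflp_on Spec le" and trans: "transp_on Spec le"
    and eq: "\<And>I1 I2. I1 \<in> Proc \<Longrightarrow> I2 \<in> Proc \<Longrightarrow> le (\<chi> I1) (\<chi> I2) \<longleftrightarrow> eq I1 I2"
    and sym: "symp_on Proc eq"
  shows "specification_theory Proc Spec \<chi> le \<and> adequate_for Proc Spec \<chi> le eq"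
proof -
  have in_Spec: "\<chi> I \<in> Spec" if "I \<in> Proc" for I
    using \<chi> that by blast
  have refl': "le D D" if "D \<in> Spec" for D
    using refl that by (rule reflp_onD)
  have trans': "le D1 D3" if "le D1 D2" "le D2 D3" "D1 \<in> Spec" "D2 \<in> Spec" "D3 \<in> Spec" for D1 D2 D3
    using transp_onD[OF trans that(3,4,5,1,2)] .
  have sym': "eq I2 I1" if "eq I1 I2" "I1 \<in> Proc" "I2 \<in> Proc" for I1 I2
    using symp_onD[OF sym that(2,3,1)] .
  have Th_eq: "Th Spec \<chi> le I1 = Th Spec \<chi> le I2 \<longleftrightarrow> eq I1 I2" if "I1 \<in> Proc" "I2 \<in> Proc" for I1 I2
  proof
    assume "Th Spec \<chi> le I1 = Th Spec \<chi> le I2"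
    \<comment> \<open>By reflexivity \<open>\<chi> I2\<close> lies in the theory of
      \<open>I2\<close>, hence in that of \<open>I1\<close>.\<close>
    then have "le (\<chi> I1) (\<chi> I2)"
      using in_Spec[OF that(2)] refl' unfolding Th_def models_def by blast
    then show "eq I1 I2"
      using eq that by blast
  next
    assume "eq I1 I2"
    then have "le (\<chi> I1) (\<chi> I2)" "le (\<chi> I2) (\<chi> I1)"
      using eq sym' that by blast+
    then show "Th Spec \<chi> le I1 = Th Spec \<chi> le I2"
      using in_Spec that trans' unfolding Th_def models_def by blast
  qed
  have "reflp_on Proc eq"
    using in_Spec refl' eq by (blast intro: reflp_onI)
  \<comment> \<open>On \<open>Proc\<close>, \<open>eq\<close> is equality of theories, so it
    inherits transitivity.\<close>
  moreover have "transp_on Proc eq"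
    by (rule transp_onI) (use Th_eq in metis)
  ultimately have "adequate_for Proc Spec \<chi> le eq"
    using sym Th_eq unfolding adequate_for_def by blast
  moreover have "specification_theory Proc Spec \<chi> le"
    unfolding specification_theory_def models_def
    using \<chi> refl trans refl'[OF in_Spec] Th_eq eq by meson
  ultimately show ?thesis
    by blast
qed


section \<open>Refinement is a preorder: identity and composition of families\<close>

lemma may_traces_target: "D \<in> DMTS \<Sigma> \<Longrightarrow> (s, \<tau>, t) \<in> may_traces D \<Longrightarrow> t \<in> dstates D"
  by (erule may_traces.cases) (auto simp: DMTS_def)

lemma must_traces_target: "D \<in> DMTS \<Sigma> \<Longrightarrow> (s, \<tau>, t) \<in> must_traces D \<Longrightarrow> t \<in> dstates D"
  by (erule must_traces.cases) (auto simp: DMTS_def)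

text \<open>Every trace can be answered by itself, so the diagonal serves at all indices. It is
  restricted to \<open>dstates D\<close> because family members relate states only; trace targets
  and initial states do lie there.\<close>

lemma dmts_ready_family_Id_on:
  assumes D: "D \<in> DMTS \<Sigma>"
  shows "dmts_ready_family k D D (\<lambda>j. Id_on (dstates D)) (\<lambda>j. Id_on (dstates D))"
proof -
  have "lmay D D s s" "lmust D D s s" "lmay_ready D D s s" "lmust_ready D D s s"
    "lmay_rel D D (Id_on (dstates D)) s s" "lmust_rel D D (Id_on (dstates D)) s s" for s
    using may_traces_target[OF D] must_traces_target[OF D]
    unfolding lmay_def lmay_rel_def lmust_def lmust_rel_def lmay_ready_def lmust_ready_def Id_on_iff
    by meson+
  moreover have "dinit D \<subseteq> dstates D"
    using D by (simp add: DMTS_def)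
  ultimately show ?thesis
    unfolding dmts_ready_family_def dmts_switching_family_def by (auto simp: Id_on_iff)
qed

lemma lmay_trans: "lmay D1 D2 s1 s2 \<Longrightarrow> lmay D2 D3 s2 s3 \<Longrightarrow> lmay D1 D3 s1 s3"
  unfolding lmay_def by meson

lemma lmust_trans: "lmust D1 D2 s1 s2 \<Longrightarrow> lmust D2 D3 s2 s3 \<Longrightarrow> lmust D1 D3 s1 s3"
  unfolding lmust_def by meson

lemma lmay_rel_trans:
  "lmay_rel D1 D2 R s1 s2 \<Longrightarrow> lmay_rel D2 D3 Q s2 s3 \<Longrightarrow> lmay_rel D1 D3 (R O Q) s1 s3"
  unfolding lmay_rel_def by (meson relcompI)

text \<open>Traces are answered from \<open>D3\<close> back to \<open>D1\<close>, but the pairs keep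
  their left-to-right orientation, so the composition is again \<open>R O Q\<close>.\<close>

lemma lmust_rel_trans:
  "lmust_rel D1 D2 R s1 s2 \<Longrightarrow> lmust_rel D2 D3 Q s2 s3 \<Longrightarrow> lmust_rel D1 D3 (R O Q) s1 s3"
  unfolding lmust_rel_def by (meson relcompI)

lemma lmay_ready_trans:
  "lmay_ready D1 D2 s1 s2 \<Longrightarrow> lmay_ready D2 D3 s2 s3 \<Longrightarrow> lmay_ready D1 D3 s1 s3"
  unfolding lmay_ready_def by meson

lemma lmust_ready_trans:
  "lmust_ready D1 D2 s1 s2 \<Longrightarrow> lmust_ready D2 D3 s2 s3 \<Longrightarrow> lmust_ready D1 D3 s1 s3"
  unfolding lmust_ready_def by meson

text \<open>The common pattern of the four switching clauses: \<open>E\<close> is the parity,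
  \<open>P\<close> and \<open>Q\<close> are instances of \<open>lmay\<close> or
  \<open>lmust\<close>, and the primed predicates are their versions relative to the relation at the
  next index.\<close>

lemma switching_conditions_relcomp:
  assumes "\<forall>j s1 s2. enat j \<le> k \<longrightarrow> E j \<longrightarrow> (s1, s2) \<in> R j \<longrightarrow>
      P s1 s2 \<and> (enat j < k \<longrightarrow> P' (R (j + 1)) s1 s2)"
    and "\<forall>j s2 s3. enat j \<le> k \<longrightarrow> E j \<longrightarrow> (s2, s3) \<in> S j \<longrightarrow>
      Q s2 s3 \<and> (enat j < k \<longrightarrow> Q' (S (j + 1)) s2 s3)"
    and "\<And>s1 s2 s3. P s1 s2 \<Longrightarrow> Q s2 s3 \<Longrightarrow> PQ s1 s3"
    and "\<And>R S s1 s2 s3. P' R s1 s2 \<Longrightarrow> Q' S s2 s3 \<Longrightarrow> PQ' (R O S) s1 s3"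
  shows "\<forall>j s1 s3. enat j \<le> k \<longrightarrow> E j \<longrightarrow> (s1, s3) \<in> R j O S j \<longrightarrow>
      PQ s1 s3 \<and> (enat j < k \<longrightarrow> PQ' (R (j + 1) O S (j + 1)) s1 s3)"
proof (intro allI impI)
  fix j s1 s3
  assume j: "enat j \<le> k" "E j" and "(s1, s3) \<in> R j O S j"
  then obtain s2 where "(s1, s2) \<in> R j" "(s2, s3) \<in> S j"
    by blast
  then show "PQ s1 s3 \<and> (enat j < k \<longrightarrow> PQ' (R (j + 1) O S (j + 1)) s1 s3)"
    using assms j by metis
qed

lemma dmts_switching_family_relcomp:
  assumes "dmts_switching_family k D1 D2 R1 R2" "dmts_switching_family k D2 D3 Q1 Q2"
  shows "dmts_switching_family k D1 D3 (\<lambda>j. R1 j O Q1 j) (\<lambda>j. R2 j O Q2 j)"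
  using assms unfolding dmts_switching_family_def
proof (elim conjE, intro conjI)
  assume "\<forall>j. enat j \<le> k \<longrightarrow> R1 j \<subseteq> dstates D1 \<times> dstates D2 \<and> R2 j \<subseteq> dstates D1 \<times> dstates D2"
    and "\<forall>j. enat j \<le> k \<longrightarrow> Q1 j \<subseteq> dstates D2 \<times> dstates D3 \<and> Q2 j \<subseteq> dstates D2 \<times> dstates D3"
  then show "\<forall>j. enat j \<le> k \<longrightarrow>
      R1 j O Q1 j \<subseteq> dstates D1 \<times> dstates D3 \<and> R2 j O Q2 j \<subseteq> dstates D1 \<times> dstates D3"
    by blast
next
  assume "\<forall>s1\<in>dinit D1. \<exists>s2\<in>dinit D2. (s1, s2) \<in> R1 0"
    and "\<forall>s2\<in>dinit D2. \<exists>s3\<in>dinit D3. (s2, s3) \<in> Q1 0"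
  then show "\<forall>s1\<in>dinit D1. \<exists>s3\<in>dinit D3. (s1, s3) \<in> R1 0 O Q1 0"
    by (meson relcompI)
next
  assume "\<forall>s2\<in>dinit D2. \<exists>s1\<in>dinit D1. (s1, s2) \<in> R2 0"
    and "\<forall>s3\<in>dinit D3. \<exists>s2\<in>dinit D2. (s2, s3) \<in> Q2 0"
  then show "\<forall>s3\<in>dinit D3. \<exists>s1\<in>dinit D1. (s1, s3) \<in> R2 0 O Q2 0"
    by (meson relcompI)
\<comment> \<open>What remains are the four switching clauses, for both parities of both
  halves.\<close>
qed (rule switching_conditions_relcomp, assumption, assumption,
    erule (1) lmay_trans lmust_trans, erule (1) lmay_rel_trans lmust_rel_trans)+

lemma dmts_ready_family_relcomp:
  assumes R: "dmts_ready_family k D1 D2 R1 R2" and Q: "dmts_ready_family k D2 D3 Q1 Q2"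
  shows "dmts_ready_family k D1 D3 (\<lambda>j. R1 j O Q1 j) (\<lambda>j. R2 j O Q2 j)"
  unfolding dmts_ready_family_def
proof (intro conjI)
  show "dmts_switching_family k D1 D3 (\<lambda>j. R1 j O Q1 j) (\<lambda>j. R2 j O Q2 j)"
    by (rule dmts_switching_family_relcomp[OF R[unfolded dmts_ready_family_def, THEN conjunct1]
          Q[unfolded dmts_ready_family_def, THEN conjunct1]])
next
  show "\<forall>n. k = enat n \<longrightarrow>
      (even n \<longrightarrow>
        (\<forall>s1 s3. (s1, s3) \<in> R1 n O Q1 n \<longrightarrow> lmay_ready D1 D3 s1 s3) \<and>
        (\<forall>s1 s3. (s1, s3) \<in> R2 n O Q2 n \<longrightarrow> lmust_ready D1 D3 s1 s3)) \<and>
      (odd n \<longrightarrow>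
        (\<forall>s1 s3. (s1, s3) \<in> R1 n O Q1 n \<longrightarrow> lmust_ready D1 D3 s1 s3) \<and>
        (\<forall>s1 s3. (s1, s3) \<in> R2 n O Q2 n \<longrightarrow> lmay_ready D1 D3 s1 s3))"
    using R Q unfolding dmts_ready_family_def
    \<comment> \<open>For \<open>k = \<infinity>\<close> the claim is vacuous; otherwise
      \<open>the_enat k\<close> is the last index, and its parity decides which half carries the may
      and which the must condition.\<close>
    by (cases k; cases "even (the_enat k)"; simp)
      (meson lmay_ready_trans lmust_ready_trans relcompEpair)+
qed

lemma reflp_on_dmts_ready_refines: "reflp_on (DMTS \<Sigma>) (dmts_ready_refines k)"
  unfolding dmts_ready_refines_def by (blast intro: reflp_onI dmts_ready_family_Id_on)

lemma reflp_on_dmts_switching_refines: "reflp_on (DMTS \<Sigma>) (dmts_switching_refines k)"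
  unfolding dmts_switching_refines_def
  by (blast intro: reflp_onI dmts_ready_family_Id_on[unfolded dmts_ready_family_def, THEN conjunct1])

lemma transp_on_dmts_ready_refines: "transp_on A (dmts_ready_refines k)"
  unfolding dmts_ready_refines_def by (blast intro: transp_onI dmts_ready_family_relcomp)

lemma transp_on_dmts_switching_refines: "transp_on A (dmts_switching_refines k)"
  unfolding dmts_switching_refines_def by (blast intro: transp_onI dmts_switching_family_relcomp)


section \<open>Traces of implementations\<close>

lemma chi_simps [simp]:
  "dstates (chi I) = lstates I" "dinit (chi I) = {linit I}" "dmay (chi I) = ltrans I"
  "(s, N) \<in> dmust (chi I) \<longleftrightarrow> (\<exists>a t. N = {(a, t)} \<and> (s, a, t) \<in> ltrans I)"
  by (auto simp: chi_def)

lemma chi_in_DMTS: "I \<in> LTS \<Sigma> \<Longrightarrow> chi I \<in> DMTS \<Sigma>"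
  by (auto simp: LTS_def DMTS_def)

lemma may_traces_chi [simp]: "may_traces (chi I) = ltraces I"
proof (intro set_eqI iffI; clarify)
  show "(s, \<tau>, t) \<in> ltraces I" if "(s, \<tau>, t) \<in> may_traces (chi I)" for s \<tau> t
    using that by induction (auto intro: ltraces.intros)
  show "(s, \<tau>, t) \<in> may_traces (chi I)" if "(s, \<tau>, t) \<in> ltraces I" for s \<tau> t
    using that by induction (auto intro: may_traces.intros)
qed

lemma must_traces_chi [simp]: "must_traces (chi I) = ltraces I"
proof (intro set_eqI iffI; clarify)
  show "(s, \<tau>, t) \<in> ltraces I" if "(s, \<tau>, t) \<in> must_traces (chi I)" for s \<tau> t
    using that by induction (auto intro: ltraces.intros)
  show "(s, \<tau>, t) \<in> must_traces (chi I)" if "(s, \<tau>, t) \<in> ltraces I" for s \<tau> t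
    using that
  proof induction
    case (snoc s \<tau> t a u)
    then show ?case
      \<comment> \<open>The last step is covered by the singleton obligation that \<open>chi\<close>
        attaches to the transition \<open>(t, a, u)\<close>.\<close>
      by (intro must_traces.snoc[of s \<tau> t _ "{(a, u)}"]) auto
  qed (simp add: must_traces.empty)
qed

section \<open>Relation families between implementations\<close>

text \<open>Brings the LTS clauses into the shape of the clauses for \<open>R1\<close> in a DMTS
  family.\<close>

lemma lts_switching_family_iff_chi:
  "lts_switching_family k I1 I2 R \<longleftrightarrow>
     (\<forall>j. enat j \<le> k \<longrightarrow> R j \<subseteq> lstates I1 \<times> lstates I2) \<and>
     (linit I1, linit I2) \<in> R 0 \<and>
     (\<forall>j s1 s2. enat j \<le> k \<longrightarrow> even j \<longrightarrow> (s1, s2) \<in> R j \<longrightarrow>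
        lmay (chi I1) (chi I2) s1 s2 \<and>
        (enat j < k \<longrightarrow> lmay_rel (chi I1) (chi I2) (R (j + 1)) s1 s2)) \<and>
     (\<forall>j s1 s2. enat j \<le> k \<longrightarrow> odd j \<longrightarrow> (s1, s2) \<in> R j \<longrightarrow>
        lmust (chi I1) (chi I2) s1 s2 \<and>
        (enat j < k \<longrightarrow> lmust_rel (chi I1) (chi I2) (R (j + 1)) s1 s2))"
  unfolding lts_switching_family_def lmay_def lmay_rel_def lmust_def lmust_rel_def
    may_traces_chi must_traces_chi ..

text \<open>The counterpart for \<open>R2\<close>: with a single trace set per implementation,
  exchanging the two systems turns the may conditions into the must conditions and
  conversely.\<close>

lemma lts_switching_family_converse_iff_chi:
  fixes I1 :: "('s, 'a) lts" and I2 :: "('t, 'a) lts"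
  shows "lts_switching_family k I2 I1 (\<lambda>j. (R j)\<inverse>) \<longleftrightarrow>
     (\<forall>j. enat j \<le> k \<longrightarrow> R j \<subseteq> lstates I1 \<times> lstates I2) \<and>
     (linit I1, linit I2) \<in> R 0 \<and>
     (\<forall>j s1 s2. enat j \<le> k \<longrightarrow> even j \<longrightarrow> (s1, s2) \<in> R j \<longrightarrow>
        lmust (chi I1) (chi I2) s1 s2 \<and>
        (enat j < k \<longrightarrow> lmust_rel (chi I1) (chi I2) (R (j + 1)) s1 s2)) \<and>
     (\<forall>j s1 s2. enat j \<le> k \<longrightarrow> odd j \<longrightarrow> (s1, s2) \<in> R j \<longrightarrow>
        lmay (chi I1) (chi I2) s1 s2 \<and>
        (enat j < k \<longrightarrow> lmay_rel (chi I1) (chi I2) (R (j + 1)) s1 s2))"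
proof -
  have "lmust (chi I1) (chi I2) s1 s2 \<longleftrightarrow> lmay (chi I2) (chi I1) s2 s1"
    "lmay (chi I1) (chi I2) s1 s2 \<longleftrightarrow> lmust (chi I2) (chi I1) s2 s1"
    "lmust_rel (chi I1) (chi I2) Q s1 s2 \<longleftrightarrow> lmay_rel (chi I2) (chi I1) (Q\<inverse>) s2 s1"
    "lmay_rel (chi I1) (chi I2) Q s1 s2 \<longleftrightarrow> lmust_rel (chi I2) (chi I1) (Q\<inverse>) s2 s1" for s1 s2 Q
    by (simp_all add: lmay_def lmust_def lmay_rel_def lmust_rel_def)
  note swap = this
  have converse_subset: "Q\<inverse> \<subseteq> B \<times> A \<longleftrightarrow> Q \<subseteq> A \<times> B" for Q :: "('s \<times> 't) set" and A B
    by auto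
  show ?thesis
    \<comment> \<open>After rewriting, the conjuncts on both sides agree up to the order in which
      the two states are quantified.\<close>
    unfolding lts_switching_family_iff_chi swap converse_iff converse_subset
    by (intro arg_cong2[where f = "(\<and>)"]; blast)
qed

text \<open>No clause links \<open>R1\<close> to \<open>R2\<close>, so the family splits; the
  initial state sets are singletons, which reduces both initial conditions to membership of one
  pair.\<close>

lemma dmts_switching_family_chi:
  "dmts_switching_family k (chi I1) (chi I2) R1 R2 \<longleftrightarrow>
     lts_switching_family k I1 I2 R1 \<and> lts_switching_family k I2 I1 (\<lambda>j. (R2 j)\<inverse>)"
  unfolding dmts_switching_family_def lts_switching_family_iff_chi[of k I1 I2]
    lts_switching_family_converse_iff_chi chi_simps imp_conjR all_conj_distrib
  by (simp only: ball_simps bex_simps simp_thms conj_ac)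

lemma all_dmust_chi:
  "(\<forall>N. (s, N) \<in> dmust (chi I) \<longrightarrow> P N) \<longleftrightarrow> (\<forall>a t. (s, a, t) \<in> ltrans I \<longrightarrow> P {(a, t)})"
  unfolding chi_simps by blast

lemma ex_dmust_chi:
  "(\<exists>N. (s, N) \<in> dmust (chi I) \<and> P N) \<longleftrightarrow> (\<exists>a t. (s, a, t) \<in> ltrans I \<and> P {(a, t)})"
  unfolding chi_simps by blast

text \<open>Obligations of implementations are singletons, so an obligation can only be answered by
  a transition with the same action: readiness becomes inclusion of the sets of enabled
  actions.\<close>

lemma lmay_ready_chi:
  "lmay_ready (chi I1) (chi I2) s1 s2 \<longleftrightarrow>
     (\<forall>\<tau> t1. (s1, \<tau>, t1) \<in> ltraces I1 \<longrightarrow>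
        (\<exists>t2. (s2, \<tau>, t2) \<in> ltraces I2 \<and>
           (\<forall>a u2. (t2, a, u2) \<in> ltrans I2 \<longrightarrow> (\<exists>u1. (t1, a, u1) \<in> ltrans I1))))"
  unfolding lmay_ready_def all_dmust_chi ex_dmust_chi by simp

lemma lmust_ready_chi:
  "lmust_ready (chi I1) (chi I2) s1 s2 \<longleftrightarrow> lmay_ready (chi I2) (chi I1) s2 s1"
  unfolding lmay_ready_chi lmust_ready_def by simp

lemma lts_ready_family_iff_chi:
  "lts_ready_family k I1 I2 R \<longleftrightarrow>
     lts_switching_family k I1 I2 R \<and>
     (\<forall>n s1 s2. k = enat n \<longrightarrow> (s1, s2) \<in> R n \<longrightarrow>
        (even n \<longrightarrow> lmay_ready (chi I1) (chi I2) s1 s2) \<and>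
        (odd n \<longrightarrow> lmay_ready (chi I2) (chi I1) s2 s1))"
  unfolding lts_ready_family_def lmay_ready_chi ..

lemma dmts_ready_family_chi:
  "dmts_ready_family k (chi I1) (chi I2) R1 R2 \<longleftrightarrow>
     lts_ready_family k I1 I2 R1 \<and> lts_ready_family k I2 I1 (\<lambda>j. (R2 j)\<inverse>)"
  unfolding dmts_ready_family_def lts_ready_family_iff_chi dmts_switching_family_chi lmust_ready_chi
    converse_iff
  by (cases k; cases "even (the_enat k)") auto

text \<open>Converse is an involution on families. This removes the converse from \<open>R2\<close>
  once families are quantified existentially.\<close>

lemma ex_converse_family: "(\<exists>R. P (\<lambda>j. (R j)\<inverse>)) \<longleftrightarrow> (\<exists>R. P R)"
proof (intro iffI; elim exE)
  fix R assume "P R"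
  then show "\<exists>R. P (\<lambda>j. (R j)\<inverse>)"
    by (intro exI[of _ "\<lambda>j. (R j)\<inverse>"]) simp
qed blast

lemma dmts_switching_refines_chi:
  "dmts_switching_refines k (chi I1) (chi I2) \<longleftrightarrow> lts_switching_equiv k I1 I2"
  unfolding dmts_switching_refines_def lts_switching_equiv_def dmts_switching_family_chi
  using ex_converse_family[of "lts_switching_family k I2 I1"] by blast

lemma dmts_ready_refines_chi:
  "dmts_ready_refines k (chi I1) (chi I2) \<longleftrightarrow> lts_ready_equiv k I1 I2"
  unfolding dmts_ready_refines_def lts_ready_equiv_def dmts_ready_family_chi
  using ex_converse_family[of "lts_ready_family k I2 I1"] by blast

theorem theorem3:
  fixes \<Sigma> :: "'a set" and k :: enat
  assumes "finite \<Sigma>"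
  shows "specification_theory (LTS \<Sigma> :: ('s, 'a) lts set) (DMTS \<Sigma>) chi
           (dmts_switching_refines k) \<and>
         adequate_for (LTS \<Sigma> :: ('s, 'a) lts set) (DMTS \<Sigma>) chi
           (dmts_switching_refines k) (lts_switching_equiv k) \<and>
         specification_theory (LTS \<Sigma> :: ('s, 'a) lts set) (DMTS \<Sigma>) chi
           (dmts_ready_refines k) \<and>
         adequate_for (LTS \<Sigma> :: ('s, 'a) lts set) (DMTS \<Sigma>) chi
           (dmts_ready_refines k) (lts_ready_equiv k)"
proof -
  have chi: "chi ` (LTS \<Sigma> :: ('s, 'a) lts set) \<subseteq> DMTS \<Sigma>"
    using chi_in_DMTS by blast
  \<comment> \<open>Both equivalences ask for families in the two directions, so exchanging the
    systems only swaps the conjuncts.\<close>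
  have "symp_on (LTS \<Sigma> :: ('s, 'a) lts set) (lts_switching_equiv k)"
    "symp_on (LTS \<Sigma> :: ('s, 'a) lts set) (lts_ready_equiv k)"
    by (auto intro!: symp_onI simp: lts_switching_equiv_def lts_ready_equiv_def)
  then show ?thesis
    using
      specification_theory_adequate_forI[OF chi reflp_on_dmts_switching_refines
        transp_on_dmts_switching_refines dmts_switching_refines_chi]
      specification_theory_adequate_forI[OF chi reflp_on_dmts_ready_refines
        transp_on_dmts_ready_refines dmts_ready_refines_chi]
    by blast
qed

end
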